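(* Let $K\subseteq\mathbb{R}^n$ be a convex body given by a membership oracle such that $B_n\subseteq K\subseteq 2nB_n$. Then any nonadaptive randomized algorithm that outputs a number $V$ such that $0.9\operatorname{vol}(K)\le V\le1.1\operatorname{vol}(K)$ holds with probability at least $3/4$ (for every such $K$) has complexity at least $\frac{1}{2e(n+2)}n^{n/2}$.
   Context: $B_n$ is the Euclidean unit ball in $\mathbb{R}^n$ centered at the origin. A membership oracle answers, for any $x\in\mathbb{R}^n$, whether $x\in K$. An algorithm is nonadaptive if its queries are independent of the input (for a randomized algorithm: the queries may depend on its random bits but not on the oracle answers). The complexity is the maximum number of oracle queries made. *)

theory Defs
  imports "HOL-Probability.Probability"
begin

definition convex_body :: "'a::euclidean_space set \<Rightarrow> bool" where
  "convex_body K \<longleftrightarrow> convex K \<and> compact K \<and> interior K \<noteq> {}"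

(*
  The random bits of a nonadaptive randomized algorithm are an element w of the probability
  space seed_space. Given w, the algorithm asks the membership oracle about the points
  query w 0, ..., query w (num_queries w - 1); neither the points nor their number can depend
  on the oracle answers, which enter only the output. There is no bound on the computation
  between queries. The values of query w i for i >= num_queries w play no role.
*)
record ('w, 'a) nonadaptive_alg =
  seed_space :: "'w measure"
  num_queries :: "'w \<Rightarrow> nat"
  query :: "'w \<Rightarrow> nat \<Rightarrow> 'a"
  answer_output :: "'w \<Rightarrow> bool list \<Rightarrow> real"

(* All ingredients are random variables, so that the output on each fixed Borel set K is one. *)
definition nonadaptive_randomized_alg :: "('w, 'a::euclidean_space) nonadaptive_alg \<Rightarrow> bool" where
  "nonadaptive_randomized_alg A \<longleftrightarrow>
     prob_space (seed_space A) \<and>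
     num_queries A \<in> measurable (seed_space A) (count_space UNIV) \<and>
     (\<forall>i. (\<lambda>w. query A w i) \<in> borel_measurable (seed_space A)) \<and>
     (\<forall>bs. (\<lambda>w. answer_output A w bs) \<in> borel_measurable (seed_space A))"

definition oracle_answers :: "('w, 'a) nonadaptive_alg \<Rightarrow> 'a set \<Rightarrow> 'w \<Rightarrow> bool list" where
  "oracle_answers A K w = map (\<lambda>i. query A w i \<in> K) [0..<num_queries A w]"

definition run :: "('w, 'a) nonadaptive_alg \<Rightarrow> 'a set \<Rightarrow> 'w \<Rightarrow> real" where
  "run A K w = answer_output A w (oracle_answers A K w)"

(* The maximum over inputs is vacuous: num_queries does not depend on the input.
   The value is infinity if the number of queries is unbounded over the random bits. *)
definition complexity :: "('w, 'a) nonadaptive_alg \<Rightarrow> enat" where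
  "complexity A = (SUP w\<in>space (seed_space A). enat (num_queries A w))"

end

theory Submission
  imports Defs
begin

text \<open>Take pairs of convex bodies \<open>S\<^sub>i \<subseteq> T\<^sub>i\<close> whose volumes differ so much that no number approximates
  both, and whose differences \<open>T\<^sub>i - S\<^sub>i\<close> are pairwise disjoint. With probability at least 1/2 the
  algorithm answers correctly on both \<open>S\<^sub>i\<close> and \<open>T\<^sub>i\<close>, and then one of its queries lies in
  \<open>T\<^sub>i - S\<^sub>i\<close>. The queries do not depend on \<open>i\<close> and each of them lies in at most one difference, so
  \<open>N\<close> pairs force at least \<open>N/2\<close> queries.

  For \<open>T\<^sub>i\<close> take a cone of height less than \<open>4n\<close> circumscribed about the unit ball, with apex at
  distance \<open>2n\<close> from the origin, and for \<open>S\<^sub>i\<close> its contraction by the factor \<open>1 - 1/(4n)\<close> towards the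
  apex. The volume drops by a factor of at least 5/4, but only a slab of thickness at most 1 is cut
  off, which lies in a ball of radius 5/2. The centre of that ball can be any point \<open>p\<close> with
  \<open>2 \<le> |p| \<le> 2n - 2\<close>, so the number of pairs is a packing number of an annulus, at least
  \<open>((2n - 2)\<^sup>n - 2\<^sup>n) / 5\<^sup>n\<close>. For \<open>n \<le> 4\<close> the claim only says that some query is asked.\<close>

section \<open>Disjoint differences force queries\<close>

text \<open>Double counting: the number of indices \<open>i\<close> for which the run is correct on
  both \<open>S i\<close> and \<open>T i\<close> has expectation at least \<open>card I / 2\<close>,
  while for every fixed seed it is at most the number of queries.\<close>

lemma queries_ge_half_card:
  fixes A :: "('w, 'a::euclidean_space) nonadaptive_alg" and S T :: "'i \<Rightarrow> 'a set"
  assumes A: "nonadaptive_randomized_alg A"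
    and fin: "finite I"
    and succ: "\<And>K. K \<in> S ` I \<union> T ` I \<Longrightarrow>
           measure (seed_space A)
             {w \<in> space (seed_space A).
                0.9 * measure lebesgue K \<le> run A K w \<and> run A K w \<le> 1.1 * measure lebesgue K} \<ge> 3 / 4"
    and sub: "\<And>i. i \<in> I \<Longrightarrow> S i \<subseteq> T i"
    and gap: "\<And>i. i \<in> I \<Longrightarrow> 1.1 * measure lebesgue (S i) < 0.9 * measure lebesgue (T i)"
    and disj: "disjoint_family_on (\<lambda>i. T i - S i) I"
    and q: "\<And>w. w \<in> space (seed_space A) \<Longrightarrow> num_queries A w \<le> q"
  shows "real (card I) \<le> 2 * real q"
proof -
  let ?M = "seed_space A"
  interpret prob_space ?M
    using A by (simp add: nonadaptive_randomized_alg_def)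
  define E where "E K = {w \<in> space ?M. 0.9 * measure lebesgue K \<le> run A K w \<and> run A K w \<le> 1.1 * measure lebesgue K}" for K
  define G where "G i = E (S i) \<inter> E (T i)" for i
  have E: "E K \<in> events" "prob (E K) \<ge> 3/4" if "K \<in> S ` I \<union> T ` I" for K
  proof -
    show "prob (E K) \<ge> 3/4" using succ[OF that] by (simp add: E_def)
    \<comment> \<open>A non-measurable set has measure 0 by convention, so the positive bound
      already yields measurability.\<close>
    then show "E K \<in> events" using measure_notin_sets[of "E K" ?M] by fastforce
  qed
  have G: "G i \<in> events" "prob (G i) \<ge> 1/2" if "i \<in> I" for i
  proof -
    have e: "E (S i) \<in> events" "E (T i) \<in> events" and p: "prob (E (S i)) \<ge> 3/4" "prob (E (T i)) \<ge> 3/4"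
      using E that by auto
    show "G i \<in> events" using e by (simp add: G_def)
    \<comment> \<open>Inclusion-exclusion; the bound obtained is 3/4 + 3/4 - 1 = 1/2.\<close>
    have "prob (E (S i)) + prob (E (T i)) = prob (E (S i) \<union> E (T i)) + prob (G i)"
      using e finite_measure_Union'[of "E (S i)" "E (T i)"] finite_measure_Diff'[of "E (T i)" "E (S i)"]
      by (simp add: G_def Int_commute)
    with p prob_le_1[of "E (S i) \<union> E (T i)"] show "prob (G i) \<ge> 1/2" by linarith
  qed
  have hit: "\<exists>j < num_queries A w. query A w j \<in> T i - S i" if i: "i \<in> I" and w: "w \<in> G i" for i w
  proof (rule ccontr)
    assume no: "\<not> ?thesis"
    \<comment> \<open>If no query falls into the difference, both bodies produce the same answers,
      hence the same output, which by \<open>gap\<close> cannot be right for both.\<close>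
    have "(query A w j \<in> S i) = (query A w j \<in> T i)" if "j < num_queries A w" for j
      using no that sub[OF i] by blast
    then have "oracle_answers A (S i) w = oracle_answers A (T i) w"
      by (simp add: oracle_answers_def)
    then have "run A (S i) w = run A (T i) w"
      by (simp add: run_def)
    with w gap[OF i] show False by (simp add: G_def E_def)
  qed
  have le: "(\<Sum>i\<in>I. indicator (G i) w) \<le> real q" if w: "w \<in> space ?M" for w
  proof -
    define J where "J = {i \<in> I. w \<in> G i}"
    have "\<forall>i\<in>J. \<exists>j < num_queries A w. query A w j \<in> T i - S i"
      using hit by (simp add: J_def)
    then obtain f where f: "\<And>i. i \<in> J \<Longrightarrow> f i < num_queries A w \<and> query A w (f i) \<in> T i - S i"
      by metis
    \<comment> \<open>A single query point cannot lie in two of the disjoint differences.\<close>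
    have "inj_on f J"
    proof (rule inj_onI, rule ccontr)
      fix i i' assume *: "i \<in> J" "i' \<in> J" "f i = f i'" "i \<noteq> i'"
      then have "(T i - S i) \<inter> (T i' - S i') = {}"
        using disj by (intro disjoint_family_onD[of "\<lambda>i. T i - S i" I]) (auto simp: J_def)
      with f[of i] f[of i'] * show False by auto
    qed
    moreover have "f ` J \<subseteq> {..<num_queries A w}" using f by auto
    ultimately have "card J \<le> num_queries A w"
      using card_inj_on_le[of f J "{..<num_queries A w}"] by simp
    also have "\<dots> \<le> q" using q w by simp
    finally have "card J \<le> q" .
    moreover have "(\<Sum>i\<in>I. indicator (G i) w) = real (card J)"
      using fin by (simp add: indicator_def J_def Int_def sum.If_cases)
    ultimately show ?thesis by simp
  qed
  have "real (card I) * (1/2) \<le> (\<Sum>i\<in>I. prob (G i))"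
    using sum_bounded_below[of I "1/2" "\<lambda>i. prob (G i)"] G by simp
  also have "\<dots> = (\<integral>w. (\<Sum>i\<in>I. indicator (G i) w) \<partial>?M)"
    using G by (subst Bochner_Integration.integral_sum) (auto simp: integrable_real_indicator less_top[symmetric])
  also have "\<dots> \<le> (\<integral>w. real q \<partial>?M)"
    using G le by (intro integral_mono Bochner_Integration.integrable_sum) (auto simp: integrable_real_indicator less_top[symmetric])
  also have "\<dots> = real q" by (simp add: prob_space)
  finally show ?thesis by simp
qed

section \<open>Packing points in an annulus\<close>

text \<open>Greedy choice by volume: as long as the ball of radius \<open>r\<close> and the balls of
  radius \<open>d\<close> about the points chosen so far do not fill the ball of radius
  \<open>R\<close>, a further point fits. Stating the inequality for all \<open>k < N\<close> lets
  it pass to smaller \<open>N\<close> in the induction.\<close>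

lemma annulus_packing:
  fixes r R d :: real
  assumes "0 \<le> r" "0 \<le> R" "0 < d"
    and "\<And>k. k < N \<Longrightarrow> real k * d ^ DIM('a) < R ^ DIM('a) - r ^ DIM('a)"
  shows "\<exists>P :: 'a::euclidean_space set. finite P \<and> card P = N \<and>
           (\<forall>p\<in>P. r \<le> norm p \<and> norm p \<le> R) \<and>
           (\<forall>p\<in>P. \<forall>p'\<in>P. p \<noteq> p' \<longrightarrow> d \<le> dist p p')"
  using assms(4)
proof (induction N)
  case 0
  show ?case by (intro exI[of _ "{}"]) auto
next
  case (Suc N)
  let ?n = "DIM('a)"
  obtain P :: "'a set" where P: "finite P" "card P = N" "\<And>p. p \<in> P \<Longrightarrow> r \<le> norm p \<and> norm p \<le> R"
    "\<And>p p'. p \<in> P \<Longrightarrow> p' \<in> P \<Longrightarrow> p \<noteq> p' \<Longrightarrow> d \<le> dist p p'"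
    using Suc by (metis less_SucI)
  have "\<not> cball 0 R \<subseteq> cball 0 r \<union> (\<Union>p\<in>P. cball p d)"
  proof
    assume *: "cball 0 R \<subseteq> cball 0 r \<union> (\<Union>p\<in>P. cball p d)"
    let ?v = "unit_ball_vol (real ?n)"
    have fm: "cball x e \<in> fmeasurable lborel" for x :: 'a and e
      by (intro fmeasurable_compact compact_cball)
    have "?v * R ^ ?n = measure lborel (cball (0::'a) R)"
      using assms by (simp add: content_cball)
    also have "\<dots> \<le> measure lborel (cball 0 r \<union> (\<Union>p\<in>P. cball p d))"
      using P(1) fm by (intro measure_mono_fmeasurable * fmeasurable.Un fmeasurable.finite_UN) auto
    also have "\<dots> \<le> measure lborel (cball (0::'a) r) + measure lborel (\<Union>p\<in>P. cball p d)"
      by (intro measure_Un_le) (use P(1) in auto)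
    also have "\<dots> \<le> measure lborel (cball (0::'a) r) + (\<Sum>p\<in>P. measure lborel (cball p d))"
      by (intro add_left_mono measure_UNION_le) (use P(1) in auto)
    also have "\<dots> = ?v * (r ^ ?n + real N * d ^ ?n)"
      using assms P(2) by (simp add: content_cball algebra_simps)
    finally have "R ^ ?n \<le> r ^ ?n + real N * d ^ ?n"
      by (simp add: mult_le_cancel_left_pos)
    with Suc.prems[of N] show False by simp
  qed
  then obtain x where x: "norm x \<le> R" "r \<le> norm x" "\<And>p. p \<in> P \<Longrightarrow> d \<le> dist p x"
    by (auto simp: subset_iff not_le dest: less_imp_le)
  have "x \<notin> P" using x(3)[of x] \<open>0 < d\<close> by auto
  then show ?case
    using P x by (intro exI[of _ "insert x P"]) (auto simp: dist_commute)
qed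

section \<open>Cones circumscribed about the unit ball\<close>

text \<open>For a unit vector \<open>u\<close> and \<open>a > 1\<close>, the half-angle has sine
  \<open>1 / a\<close>. The unsquared inequality excludes the opposite nappe. The apex is placed at
  0 so that rescaling \<open>L\<close> is a dilation.\<close>

definition circular_cone :: "real \<Rightarrow> 'a::euclidean_space \<Rightarrow> real \<Rightarrow> 'a set" where
  "circular_cone a u L = {y. sqrt (a\<^sup>2 - 1) * norm y \<le> a * (y \<bullet> u) \<and> y \<bullet> u \<le> L}"

text \<open>For a unit vector \<open>u\<close>, the apex is \<open>-a u\<close> and \<open>L\<close> is the distance from the apex to the base; the
  opening angle is the one that makes the lateral surface tangent to the unit ball.\<close>

definition cone_body :: "real \<Rightarrow> 'a::euclidean_space \<Rightarrow> real \<Rightarrow> 'a set" where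
  "cone_body a u L = (+) (- (a *\<^sub>R u)) ` circular_cone a u L"

lemma mem_cone_body: "x \<in> cone_body a u L \<longleftrightarrow> x + a *\<^sub>R u \<in> circular_cone a u L"
proof
  assume "x + a *\<^sub>R u \<in> circular_cone a u L"
  then have "- (a *\<^sub>R u) + (x + a *\<^sub>R u) \<in> cone_body a u L"
    unfolding cone_body_def by (rule imageI)
  then show "x \<in> cone_body a u L" by simp
qed (auto simp: cone_body_def)

lemma circular_cone_mono: "L \<le> L' \<Longrightarrow> circular_cone a u L \<subseteq> circular_cone a u L'"
  by (auto simp: circular_cone_def)

text \<open>The squared inequality is polynomial in inner products, as the later estimates require.
  Squaring loses the sign of \<open>y \<bullet> u\<close>, which is therefore recorded
  separately.\<close>

lemma circular_cone_bounds:
  assumes "y \<in> circular_cone a u L" "1 < a"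
  shows "0 \<le> y \<bullet> u" "y \<bullet> u \<le> L" "(a\<^sup>2 - 1) * (norm y)\<^sup>2 \<le> a\<^sup>2 * (y \<bullet> u)\<^sup>2"
proof -
  have a: "a\<^sup>2 - 1 > 0" using \<open>1 < a\<close> by (simp add: one_less_power)
  have y: "sqrt (a\<^sup>2 - 1) * norm y \<le> a * (y \<bullet> u)" "0 \<le> sqrt (a\<^sup>2 - 1) * norm y"
    using assms a by (auto simp: circular_cone_def)
  then have "0 \<le> a * (y \<bullet> u)" by linarith
  then show "0 \<le> y \<bullet> u" using \<open>1 < a\<close> by (simp add: zero_le_mult_iff)
  show "y \<bullet> u \<le> L" using assms by (simp add: circular_cone_def)
  show "(a\<^sup>2 - 1) * (norm y)\<^sup>2 \<le> a\<^sup>2 * (y \<bullet> u)\<^sup>2"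
    using power_mono[OF y, of 2] a by (simp add: power_mult_distrib)
qed

lemma convex_circular_cone: "1 < a \<Longrightarrow> convex (circular_cone a u L)"
proof -
  assume "1 < a"
  then have a: "0 \<le> a\<^sup>2 - 1" by (simp add: one_le_power)
  show ?thesis
  proof (rule convexI)
    fix x y and s t :: real
    assume x: "x \<in> circular_cone a u L" and y: "y \<in> circular_cone a u L" and st: "0 \<le> s" "0 \<le> t" "s + t = 1"
    have "sqrt (a\<^sup>2 - 1) * norm (s *\<^sub>R x + t *\<^sub>R y) \<le> sqrt (a\<^sup>2 - 1) * (s * norm x + t * norm y)"
      using a st norm_triangle_ineq[of "s *\<^sub>R x" "t *\<^sub>R y"] by (intro mult_left_mono) auto
    also have "\<dots> = s * (sqrt (a\<^sup>2 - 1) * norm x) + t * (sqrt (a\<^sup>2 - 1) * norm y)"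
      by (simp add: algebra_simps)
    also have "\<dots> \<le> s * (a * (x \<bullet> u)) + t * (a * (y \<bullet> u))"
      using x y st by (intro add_mono mult_left_mono) (auto simp: circular_cone_def)
    finally have "sqrt (a\<^sup>2 - 1) * norm (s *\<^sub>R x + t *\<^sub>R y) \<le> a * ((s *\<^sub>R x + t *\<^sub>R y) \<bullet> u)"
      by (simp add: inner_add_left algebra_simps)
    moreover have "(s *\<^sub>R x + t *\<^sub>R y) \<bullet> u \<le> L"
      using x y st convex_bound_le[of "x \<bullet> u" L "y \<bullet> u" s t] by (simp add: circular_cone_def inner_add_left)
    ultimately show "s *\<^sub>R x + t *\<^sub>R y \<in> circular_cone a u L" by (simp add: circular_cone_def)
  qed
qed

lemma closed_circular_cone: "closed (circular_cone a u L)"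
  unfolding circular_cone_def by (intro closed_Collect_conj closed_Collect_le continuous_intros)

lemma circular_cone_scale:
  assumes "0 < s"
  shows "circular_cone a u (s * L) = (*\<^sub>R) s ` circular_cone a u L"
proof -
  have "(1 / s) *\<^sub>R y \<in> circular_cone a u L \<longleftrightarrow> y \<in> circular_cone a u (s * L)" for y
    using assms by (simp add: circular_cone_def field_simps)
  then show ?thesis
    using assms by (force simp: image_iff intro: bexI[of _ "(1 / s) *\<^sub>R _"])
qed

text \<open>Rescaling \<open>L\<close> is a homothety about the apex: both bodies are affine images
  of the same cone, with factors \<open>s\<close> and 1.\<close>

lemma measure_cone_body_scale:
  fixes u :: "'a::euclidean_space"
  assumes "0 < s"
  shows "measure lebesgue (cone_body a u (s * L)) = s ^ DIM('a) * measure lebesgue (cone_body a u L)"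
proof -
  have "cone_body a u (s * L) = (\<lambda>x. s *\<^sub>R x + - (a *\<^sub>R u)) ` circular_cone a u L"
    by (simp add: cone_body_def circular_cone_scale[OF assms] image_image)
  moreover have "cone_body a u L = (\<lambda>x. 1 *\<^sub>R x + - (a *\<^sub>R u)) ` circular_cone a u L"
    by (simp add: cone_body_def)
  ultimately show ?thesis
    using assms by (simp only: measure_lebesgue_affine) simp
qed

text \<open>The lateral surface is tangent to the ball, and the base plane is at distance
  \<open>L - a\<close>, at least 1, from the origin.\<close>

lemma unit_ball_subset_cone_body:
  fixes u :: "'a::euclidean_space"
  assumes u: "norm u = 1" and a: "1 < a" and L: "a + 1 \<le> L"
  shows "cball 0 1 \<subseteq> cone_body a u L"
proof
  fix x :: 'a assume "x \<in> cball 0 1"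
  then have x: "norm x \<le> 1" by simp
  let ?t = "x \<bullet> u"
  have t: "\<bar>?t\<bar> \<le> 1" using Cauchy_Schwarz_ineq2[of x u] u x by simp
  have uu: "u \<bullet> u = 1" using u by (simp add: norm_eq_1)
  have a2: "0 < a\<^sup>2 - 1" using a by (simp add: one_less_power)
  have "x \<bullet> x \<le> 1" using x by (simp add: dot_square_norm power_le_one)
  then have "(norm (x + a *\<^sub>R u))\<^sup>2 \<le> 1 + 2 * a * ?t + a\<^sup>2"
    unfolding power2_norm_eq_inner
    by (simp add: inner_add_left inner_add_right uu inner_commute power2_eq_square algebra_simps)
  then have "(a\<^sup>2 - 1) * (norm (x + a *\<^sub>R u))\<^sup>2 \<le> (a\<^sup>2 - 1) * (1 + 2 * a * ?t + a\<^sup>2)"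
    using a2 by (intro mult_left_mono) auto
  \<comment> \<open>The subtracted square vanishes at \<open>?t = - 1 / a\<close>, the height of the
    points of tangency.\<close>
  also have "\<dots> = (a * (?t + a))\<^sup>2 - (a * ?t + 1)\<^sup>2"
    by (simp add: power2_eq_square algebra_simps)
  also have "\<dots> \<le> (a * (?t + a))\<^sup>2" by simp
  finally have "(sqrt (a\<^sup>2 - 1) * norm (x + a *\<^sub>R u))\<^sup>2 \<le> (a * (?t + a))\<^sup>2"
    using a2 by (simp add: power_mult_distrib)
  then have "sqrt (a\<^sup>2 - 1) * norm (x + a *\<^sub>R u) \<le> a * (?t + a)"
    by (rule power2_le_imp_le) (use t a in auto)
  then show "x \<in> cone_body a u L"
    using t L by (simp add: mem_cone_body circular_cone_def inner_add_left uu)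
qed

text \<open>The distance from the origin is largest at the apex, where it is \<open>a\<close>, or on
  the rim of the base; the hypothesis on \<open>L\<close> keeps the rim within distance
  \<open>a\<close>.\<close>

lemma cone_body_subset_cball:
  assumes u: "norm u = 1" and a: "1 < a" and L: "a * L \<le> 2 * (a\<^sup>2 - 1)"
  shows "cone_body a u L \<subseteq> cball 0 a"
proof
  fix x assume "x \<in> cone_body a u L"
  then have "x + a *\<^sub>R u \<in> circular_cone a u L" by (simp add: mem_cone_body)
  define y where "y = x + a *\<^sub>R u"
  define t where "t = y \<bullet> u"
  note b = circular_cone_bounds[OF \<open>x + a *\<^sub>R u \<in> circular_cone a u L\<close> a, folded y_def, folded t_def]
  have uu: "u \<bullet> u = 1" using u by (simp add: norm_eq_1)
  have a2: "0 < a\<^sup>2 - 1" using a by (simp add: one_less_power)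
  have x: "x = y - a *\<^sub>R u" by (simp add: y_def)
  have "(norm x)\<^sup>2 = (norm y)\<^sup>2 - 2 * a * t + a\<^sup>2"
    unfolding power2_norm_eq_inner x t_def
    by (simp add: inner_diff_left inner_diff_right uu inner_commute power2_eq_square algebra_simps)
  then have "(a\<^sup>2 - 1) * (norm x)\<^sup>2 = (a\<^sup>2 - 1) * (norm y)\<^sup>2 - 2 * a * t * (a\<^sup>2 - 1) + (a\<^sup>2 - 1) * a\<^sup>2"
    by (simp only: distrib_left right_diff_distrib mult.commute)
  also have "\<dots> \<le> a\<^sup>2 * t\<^sup>2 - 2 * a * t * (a\<^sup>2 - 1) + (a\<^sup>2 - 1) * a\<^sup>2"
    using b(3) by simp
  \<comment> \<open>The first summand is a quadratic in \<open>t\<close>, nonpositive between its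
    zeros \<open>t = 0\<close>, the apex, and \<open>a * t = 2 * (a\<^sup>2 - 1)\<close>.\<close>
  also have "\<dots> = a * t * (a * t - 2 * (a\<^sup>2 - 1)) + (a\<^sup>2 - 1) * a\<^sup>2"
    by (simp add: power2_eq_square algebra_simps)
  also have "\<dots> \<le> (a\<^sup>2 - 1) * a\<^sup>2"
  proof -
    have "a * t \<le> a * L" using a b by simp
    with L have "a * t - 2 * (a\<^sup>2 - 1) \<le> 0" by linarith
    then have "a * t * (a * t - 2 * (a\<^sup>2 - 1)) \<le> 0"
      using a b by (intro mult_nonneg_nonpos) auto
    then show ?thesis by linarith
  qed
  finally have "(norm x)\<^sup>2 \<le> a\<^sup>2" using a2 by simp
  then show "x \<in> cball 0 a" using a by (simp add: abs_le_square_iff[symmetric])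
qed

text \<open>Pythagoras about the point of the axis at distance \<open>L - 1/2\<close> from the apex:
  the offset along the axis is at most 1/2, the squared distance to the axis is below 6, and 1/4 + 6
  = 25/4.\<close>

lemma cone_body_diff_subset_ball:
  assumes u: "norm u = 1" and a: "1 < a" and L: "L\<^sup>2 < 6 * (a\<^sup>2 - 1)" and M: "L - 1 \<le> M"
  shows "cone_body a u L - cone_body a u M \<subseteq> ball ((L - a - 1/2) *\<^sub>R u) (5/2)"
proof
  fix x assume x: "x \<in> cone_body a u L - cone_body a u M"
  define y where "y = x + a *\<^sub>R u"
  define t where "t = y \<bullet> u"
  have y: "y \<in> circular_cone a u L" "y \<notin> circular_cone a u M" using x by (auto simp: mem_cone_body y_def)
  note b = circular_cone_bounds[OF y(1) a, folded t_def]
  have tM: "M < t" using y by (auto simp: circular_cone_def t_def)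
  have uu: "u \<bullet> u = 1" using u by (simp add: norm_eq_1)
  have a2: "0 < a\<^sup>2 - 1" using a by (simp add: one_less_power)
  have "(a\<^sup>2 - 1) * ((norm y)\<^sup>2 - t\<^sup>2) \<le> t\<^sup>2" using b(3) by (simp add: algebra_simps)
  also have "t\<^sup>2 \<le> L\<^sup>2" using b by (intro power_mono) auto
  also note L
  finally have "(a\<^sup>2 - 1) * ((norm y)\<^sup>2 - t\<^sup>2) < (a\<^sup>2 - 1) * 6" by (simp only: mult.commute)
  then have 1: "(norm y)\<^sup>2 - t\<^sup>2 < 6" using a2 by (simp only: mult_less_cancel_left_pos)
  have "\<bar>t - (L - 1/2)\<bar> \<le> 1/2" using tM M b(2) by linarith
  then have "(t - (L - 1/2))\<^sup>2 \<le> (1/2)\<^sup>2" by (simp add: abs_le_square_iff[symmetric])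
  moreover have "(norm (y - (L - 1/2) *\<^sub>R u))\<^sup>2 = (t - (L - 1/2))\<^sup>2 + ((norm y)\<^sup>2 - t\<^sup>2)"
    unfolding power2_norm_eq_inner t_def
    by (simp add: inner_diff_left inner_diff_right uu inner_commute power2_eq_square algebra_simps)
  ultimately have "(norm (y - (L - 1/2) *\<^sub>R u))\<^sup>2 < (5/2)\<^sup>2"
    using 1 by (simp add: power2_eq_square)
  then have "norm (y - (L - 1/2) *\<^sub>R u) < 5/2" by (rule power2_less_imp_less) simp
  moreover have "y - (L - 1/2) *\<^sub>R u = x - (L - a - 1/2) *\<^sub>R u"
    by (simp add: y_def algebra_simps)
  ultimately show "x \<in> ball ((L - a - 1/2) *\<^sub>R u) (5/2)"
    by (simp add: dist_norm norm_minus_commute)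
qed

lemma convex_body_cone_body:
  assumes u: "norm u = 1" and a: "1 < a" and L: "a + 1 \<le> L" "a * L \<le> 2 * (a\<^sup>2 - 1)"
  shows "convex_body (cone_body a u L)"
  unfolding convex_body_def
proof (intro conjI)
  show "convex (cone_body a u L)"
    using convex_circular_cone[OF a] by (simp add: cone_body_def convex_translation)
  have "bounded (cone_body a u L)"
    using cone_body_subset_cball[OF u a L(2)] bounded_cball bounded_subset by blast
  then show "compact (cone_body a u L)"
    unfolding compact_eq_bounded_closed cone_body_def
    using closed_translation[OF closed_circular_cone] by blast
  have "ball 0 1 \<subseteq> interior (cone_body a u L)"
    using unit_ball_subset_cone_body[OF u a L(1)] by (intro interior_maximal) auto
  then show "interior (cone_body a u L) \<noteq> {}" by force
qed

section \<open>Volume gap within a pair\<close>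

lemma measure_lebesgue_pos:
  fixes K :: "'a::euclidean_space set"
  assumes "convex_body K" "cball 0 1 \<subseteq> K"
  shows "0 < measure lebesgue K"
proof -
  have "0 < measure lebesgue (cball (0::'a) 1)"
    using content_cball_pos[of 1 "0::'a"] by simp
  also have "\<dots> \<le> measure lebesgue K"
    using assms by (intro measure_mono_fmeasurable) (auto simp: convex_body_def lmeasurable_compact)
  finally show ?thesis .
qed

text \<open>With b = 1/(4n), the product (1 - b)(1 + b) is at most 1 and Bernoulli gives (1 + b)^n
  at least 5/4; finally 1.1 * 4/5 = 0.88.\<close>

lemma scale_gap:
  fixes n :: nat
  assumes "1 \<le> n"
  shows "1.1 * (1 - 1 / (4 * real n)) ^ n < (0.9 :: real)"
proof -
  let ?b = "1 / (4 * real n)"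
  have "(1 - ?b) * (1 + ?b) \<le> 1" by (simp add: algebra_simps)
  moreover have b: "0 \<le> 1 - ?b" using assms by (simp add: field_simps)
  ultimately have "((1 - ?b) * (1 + ?b)) ^ n \<le> 1" by (intro power_le_one) auto
  then have "(1 - ?b) ^ n * (1 + ?b) ^ n \<le> 1" by (simp add: power_mult_distrib)
  moreover have "5/4 \<le> (1 + ?b) ^ n"
    using Bernoulli_inequality[of ?b n] assms by (simp add: order_trans[of "-1" 0])
  then have "(1 - ?b) ^ n * (5/4) \<le> (1 - ?b) ^ n * (1 + ?b) ^ n"
    using b by (intro mult_left_mono) auto
  ultimately show ?thesis by simp
qed

section \<open>Query bounds from explicit pairs\<close>

lemma query_lower_bound_packing:
  fixes A :: "('w, 'a::euclidean_space) nonadaptive_alg"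
  assumes A: "nonadaptive_randomized_alg A"
    and succ: "\<And>K :: 'a set.
           convex_body K \<Longrightarrow> cball 0 1 \<subseteq> K \<Longrightarrow> K \<subseteq> cball 0 (2 * real DIM('a)) \<Longrightarrow>
           measure (seed_space A)
             {w \<in> space (seed_space A).
                0.9 * measure lebesgue K \<le> run A K w \<and> run A K w \<le> 1.1 * measure lebesgue K} \<ge> 3 / 4"
    and n: "2 \<le> DIM('a)"
    and q: "\<And>w. w \<in> space (seed_space A) \<Longrightarrow> num_queries A w \<le> q"
  shows "(2 * real DIM('a) - 2) ^ DIM('a) - 2 ^ DIM('a) \<le> 2 * real q * 5 ^ DIM('a)"
proof (rule ccontr)
  assume neg: "\<not> ?thesis"
  let ?n = "DIM('a)"
  have "real k * 5 ^ ?n < (2 * real ?n - 2) ^ ?n - 2 ^ ?n" if "k < Suc (2 * q)" for k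
  proof -
    have "real k * 5 ^ ?n \<le> 2 * real q * 5 ^ ?n" using that by (intro mult_right_mono) auto
    with neg show ?thesis by linarith
  qed
  \<comment> \<open>One point more than the \<open>2 * q\<close> pairs that \<open>q\<close> queries
    can serve. Distance 5 is twice the radius of the balls containing the differences. The inner
    radius keeps the unit ball inside the contracted cone, the outer one keeps the cone inside
    \<open>cball 0 a\<close>.\<close>
  then obtain P :: "'a set" where P: "finite P" "card P = Suc (2 * q)"
      "\<And>p. p \<in> P \<Longrightarrow> 2 \<le> norm p \<and> norm p \<le> 2 * real ?n - 2"
      "\<And>p p'. p \<in> P \<Longrightarrow> p' \<in> P \<Longrightarrow> p \<noteq> p' \<Longrightarrow> 5 \<le> dist p p'"
    using annulus_packing[where 'a = 'a and r = 2 and R = "2 * real ?n - 2" and d = 5 and N = "Suc (2 * q)"] n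
    by auto
  define a where "a = 2 * real ?n"
  define s where "s = 1 - 1 / (4 * real ?n)"
  \<comment> \<open>Chosen so that the ball around the slab, centred at distance
    \<open>L p - a - 1/2\<close> from the origin in direction \<open>sgn p\<close>, has centre
    \<open>p\<close>.\<close>
  define L where "L p = a + norm p + 1/2" for p :: 'a
  define T where "T p = cone_body a (sgn p) (L p)" for p :: 'a
  define S where "S p = cone_body a (sgn p) (s * L p)" for p :: 'a
  have a: "4 \<le> a" using n by (simp add: a_def)
  have s: "0 < s" "s < 1" using n by (auto simp: s_def field_simps)
  have facts: "norm (sgn p) = 1" "a + 1 \<le> s * L p" "s * L p \<le> L p" "L p - 1 \<le> s * L p"
      "L p \<le> 2 * a - 3/2" "0 \<le> L p" if "p \<in> P" for p
  proof -
    note p = P(3)[OF that]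
    show "norm (sgn p) = 1" using p by (auto simp: norm_sgn)
    show L: "L p \<le> 2 * a - 3/2" "0 \<le> L p" using p a by (auto simp: L_def a_def)
    \<comment> \<open>Since \<open>a\<close> is twice the dimension,
      \<open>s = 1 - 1 / (2 * a)\<close>; as \<open>L p\<close> is below \<open>2 * a\<close>, the
      base moves by at most 1.\<close>
    have "s * L p = L p - L p / (2 * a)" by (simp add: s_def a_def algebra_simps)
    moreover have "L p / (2 * a) \<le> 1" "0 \<le> L p / (2 * a)" using L a by (auto simp: field_simps)
    ultimately show "s * L p \<le> L p" and *: "L p - 1 \<le> s * L p" by linarith+
    show "a + 1 \<le> s * L p" using * p by (simp add: L_def)
  qed
  have ok: "a * M \<le> 2 * (a\<^sup>2 - 1)" if "M \<le> 2 * a - 3/2" for M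
  proof -
    have "a * M \<le> a * (2 * a - 3/2)" using that a by (intro mult_left_mono) auto
    also have "\<dots> \<le> 2 * (a\<^sup>2 - 1)" using a by (simp add: power2_eq_square algebra_simps)
    finally show ?thesis .
  qed
  have body: "convex_body (cone_body a (sgn p) M) \<and> cball 0 1 \<subseteq> cone_body a (sgn p) M
       \<and> cone_body a (sgn p) M \<subseteq> cball 0 a"
    if "p \<in> P" "a + 1 \<le> M" "M \<le> L p" for p M
    using convex_body_cone_body[of "sgn p" a M] unit_ball_subset_cone_body[of "sgn p" a M]
      cone_body_subset_cball[of "sgn p" a M] facts[OF that(1)] that ok[of M] a by auto
  have ST: "convex_body K" "cball 0 1 \<subseteq> K" "K \<subseteq> cball 0 a" if K: "K \<in> S ` P \<union> T ` P" for K
  proof -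
    obtain p where p: "p \<in> P" "K = S p \<or> K = T p" using K by blast
    have "a + 1 \<le> L p" using facts(2,3)[OF p(1)] by linarith
    then obtain M where M: "K = cone_body a (sgn p) M" "a + 1 \<le> M" "M \<le> L p"
      using p(2) facts(2,3)[OF p(1)] unfolding S_def T_def by (metis order_refl)
    from body[OF p(1) M(2,3)] show "convex_body K" "cball 0 1 \<subseteq> K" "K \<subseteq> cball 0 a"
      by (simp_all add: M(1))
  qed
  have "real (card P) \<le> 2 * real q"
  proof (rule queries_ge_half_card[OF A P(1), of S T])
    show "3 / 4 \<le> measure (seed_space A) {w \<in> space (seed_space A).
        0.9 * measure lebesgue K \<le> run A K w \<and> run A K w \<le> 1.1 * measure lebesgue K}"
      if "K \<in> S ` P \<union> T ` P" for K
      using ST[OF that] succ by (simp add: a_def)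
    show "S p \<subseteq> T p" if "p \<in> P" for p
      using circular_cone_mono[of "s * L p" "L p" a "sgn p"] facts(3)[OF that]
      by (auto simp: S_def T_def mem_cone_body)
    show "1.1 * measure lebesgue (S p) < 0.9 * measure lebesgue (T p)" if "p \<in> P" for p
    proof -
      have "0 < measure lebesgue (T p)" using ST[of "T p"] that by (intro measure_lebesgue_pos) auto
      moreover have "1.1 * s ^ ?n < 0.9" unfolding s_def using n by (intro scale_gap) auto
      ultimately have "1.1 * s ^ ?n * measure lebesgue (T p) < 0.9 * measure lebesgue (T p)"
        by (rule mult_strict_right_mono[rotated])
      then show ?thesis
        using measure_cone_body_scale[OF s(1), of a "sgn p" "L p"] by (simp add: S_def T_def)
    qed
    have near: "T p - S p \<subseteq> ball p (5/2)" if "p \<in> P" for p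
    proof -
      \<comment> \<open>The squared distance to the axis stays below 6 because
        \<open>4 * a\<^sup>2 < 6 * (a\<^sup>2 - 1)\<close> once
        \<open>a\<^sup>2 > 3\<close>.\<close>
      have "(L p)\<^sup>2 \<le> (2 * a)\<^sup>2" using facts[OF that] by (intro power_mono) auto
      moreover have "4\<^sup>2 \<le> a\<^sup>2" using a by (intro power_mono) auto
      ultimately have "(L p)\<^sup>2 < 6 * (a\<^sup>2 - 1)" by (simp add: power_mult_distrib)
      then have "T p - S p \<subseteq> ball ((L p - a - 1/2) *\<^sub>R sgn p) (5/2)"
        unfolding T_def S_def using facts[OF that] a by (intro cone_body_diff_subset_ball) auto
      moreover have "p \<noteq> 0" using P(3)[OF that] by auto
      then have "(L p - a - 1/2) *\<^sub>R sgn p = p"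
        by (simp add: L_def sgn_div_norm)
      ultimately show ?thesis by simp
    qed
    show "disjoint_family_on (\<lambda>p. T p - S p) P"
      unfolding disjoint_family_on_def
    proof (intro ballI impI)
      fix p p' assume "p \<in> P" "p' \<in> P" "p \<noteq> p'"
      then have "ball p (5/2) \<inter> ball p' (5/2) = {}"
        using P(4) by (intro disjoint_ballI) auto
      with near \<open>p \<in> P\<close> \<open>p' \<in> P\<close> show "(T p - S p) \<inter> (T p' - S p') = {}" by blast
    qed
  qed (use q in auto)
  with P(2) show False by simp
qed

text \<open>Serves the small dimensions. One pair suffices, the balls of radii 1 and 2: their
  volumes differ by a factor of at least 2, which exceeds 1.1/0.9.\<close>

lemma query_lower_bound_one:
  fixes A :: "('w, 'a::euclidean_space) nonadaptive_alg"
  assumes A: "nonadaptive_randomized_alg A"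
    and succ: "\<And>K :: 'a set.
           convex_body K \<Longrightarrow> cball 0 1 \<subseteq> K \<Longrightarrow> K \<subseteq> cball 0 (2 * real DIM('a)) \<Longrightarrow>
           measure (seed_space A)
             {w \<in> space (seed_space A).
                0.9 * measure lebesgue K \<le> run A K w \<and> run A K w \<le> 1.1 * measure lebesgue K} \<ge> 3 / 4"
    and q: "\<And>w. w \<in> space (seed_space A) \<Longrightarrow> num_queries A w \<le> q"
  shows "1 \<le> q"
proof -
  have n: "1 \<le> DIM('a)" by (simp add: Suc_leI)
  have "real (card {()}) \<le> 2 * real q"
  proof (rule queries_ge_half_card[OF A, of "{()}" "\<lambda>_. cball 0 1" "\<lambda>_. cball 0 2"])
    fix K :: "'a set" assume "K \<in> (\<lambda>_. cball 0 1) ` {()} \<union> (\<lambda>_. cball 0 2) ` {()}"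
    moreover have "2 \<le> 2 * real DIM('a)" using n by simp
    then have "cball (0::'a) 2 \<subseteq> cball 0 (2 * real DIM('a))" by (rule subset_cball)
    ultimately have "convex_body K \<and> cball 0 1 \<subseteq> K \<and> K \<subseteq> cball 0 (2 * real DIM('a))"
      by (auto simp: convex_body_def)
    then show "3 / 4 \<le> measure (seed_space A) {w \<in> space (seed_space A).
        0.9 * measure lebesgue K \<le> run A K w \<and> run A K w \<le> 1.1 * measure lebesgue K}"
      using succ by simp
  next
    have "2 ^ 1 \<le> (2::real) ^ DIM('a)" using n by (intro power_increasing) auto
    then have "1.1 * unit_ball_vol (real DIM('a)) < 0.9 * (2 ^ DIM('a) * unit_ball_vol (real DIM('a)))"
      using mult_right_mono[of 2 "2 ^ DIM('a)" "unit_ball_vol (real DIM('a))"]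
        unit_ball_vol_pos[of "real DIM('a)"] by simp
    then show "1.1 * measure lebesgue (cball (0::'a) 1) < 0.9 * measure lebesgue (cball (0::'a) 2)"
      using content_cball[of 1 "0::'a"] content_cball[of 2 "0::'a"] by (simp add: mult.commute)
  qed (use q in \<open>auto simp: disjoint_family_on_def\<close>)
  then show ?thesis by simp
qed

section \<open>Comparison with the claimed bound\<close>

text \<open>Compares the bases of n-th powers: 5 sqrt(n) is at most 2n - 2 for n = 9 and beyond, but
  not for n = 8. The factor in front of the power enters only through the bound 1/4.\<close>

lemma packing_bound_large:
  fixes n :: nat
  assumes "9 \<le> n"
  shows "5 ^ n * (2 * (1 / (2 * exp 1 * (real n + 2)) * real n powr (real n / 2)))
    \<le> (2 * real n - 2) ^ n - 2 ^ n"
proof -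
  define X where "X = real n powr (real n / 2)"
  have X: "X = sqrt (real n) ^ n"
    using assms by (simp add: X_def powr_half_sqrt_powr powr_realpow real_sqrt_power)
  have "2 \<le> sqrt (real n)" using assms by (intro real_le_rsqrt) auto
  then have "2 ^ 1 \<le> sqrt (real n) ^ 1" by simp
  also have "\<dots> \<le> X" unfolding X using assms by (intro power_increasing) (auto simp: real_le_rsqrt)
  finally have X2: "2 \<le> X" by simp
  have e: "2 * exp 1 * (real n + 2) \<ge> 2 * 1 * 2"
    using exp_ge_add_one_self[of 1] by (intro mult_mono) auto
  have "1 / (2 * exp 1 * (real n + 2)) \<le> 1 / 4"
    using e by (intro divide_left_mono) auto
  then have "1 / (2 * exp 1 * (real n + 2)) * X \<le> 1/4 * X"
    using X2 by (intro mult_right_mono) auto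
  \<comment> \<open>Half of \<open>X\<close> is at most \<open>X - 1\<close>; the subtracted 1 turns
    into \<open>5 ^ n\<close>, which pays for \<open>2 ^ n\<close>.\<close>
  then have "2 * (1 / (2 * exp 1 * (real n + 2)) * X) \<le> X - 1"
    using X2 by linarith
  then have "5 ^ n * (2 * (1 / (2 * exp 1 * (real n + 2)) * X)) \<le> 5 ^ n * (X - 1)"
    by (intro mult_left_mono) auto
  also have "\<dots> = (5 * sqrt (real n)) ^ n - 5 ^ n"
    by (simp add: X power_mult_distrib algebra_simps)
  also have "\<dots> \<le> (2 * real n - 2) ^ n - 2 ^ n"
  proof -
    have "(5 * sqrt (real n))\<^sup>2 \<le> (2 * real n - 2)\<^sup>2"
    proof -
      \<comment> \<open>The difference of the two squares, 4n^2 - 33n + 4, in a form whose sign is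
        visible.\<close>
      have "0 \<le> (real n - 9) * (4 * real n + 3) + 31" using assms by simp
      then show ?thesis by (simp add: power_mult_distrib) (simp add: power2_eq_square algebra_simps)
    qed
    then have "5 * sqrt (real n) \<le> 2 * real n - 2"
      by (rule power2_le_imp_le) (use assms in auto)
    then have "(5 * sqrt (real n)) ^ n \<le> (2 * real n - 2) ^ n"
      by (intro power_mono) auto
    moreover have "(2::real) ^ n \<le> 5 ^ n" by (intro power_mono) auto
    ultimately show ?thesis by linarith
  qed
  finally show ?thesis by (simp add: X_def)
qed

text \<open>Replaces e by 2 and the exponent n/2 by an integer above it, so that small dimensions
  become arithmetic with numerals.\<close>

lemma powr_half_bound:
  fixes n m :: nat
  assumes "1 \<le> n" "n \<le> 2 * m"
  shows "1 / (2 * exp 1 * (real n + 2)) * real n powr (real n / 2) \<le> real n ^ m / (4 * (real n + 2))"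
proof -
  have "real n powr (real n / 2) \<le> real n powr real m"
    using assms by (intro powr_mono) auto
  then have "real n powr (real n / 2) \<le> real n ^ m" using assms by (simp add: powr_realpow)
  moreover have "1 / (2 * exp 1 * (real n + 2)) \<le> 1 / (4 * (real n + 2))"
    using exp_ge_add_one_self[of 1] by (intro divide_left_mono mult_right_mono) auto
  ultimately show ?thesis
    using mult_mono[of "1 / (2 * exp 1 * (real n + 2))" "1 / (4 * (real n + 2))"
        "real n powr (real n / 2)" "real n ^ m"] by simp
qed

theorem theorem26:
  fixes A :: "('w, real ^ 'n) nonadaptive_alg"
  assumes "nonadaptive_randomized_alg A"
    and "\<And>K :: (real ^ 'n) set.
           convex_body K \<Longrightarrow> cball 0 1 \<subseteq> K \<Longrightarrow> K \<subseteq> cball 0 (2 * real CARD('n)) \<Longrightarrow>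
           measure (seed_space A)
             {w \<in> space (seed_space A).
                0.9 * measure lebesgue K \<le> run A K w \<and> run A K w \<le> 1.1 * measure lebesgue K} \<ge> 3 / 4"
  shows "ereal (1 / (2 * exp 1 * (real CARD('n) + 2)) * real CARD('n) powr (real CARD('n) / 2))
           \<le> ereal_of_enat (complexity A)"
proof (cases "complexity A")
  case infinity
  then show ?thesis by simp
next
  case (enat q)
  let ?n = "CARD('n)"
  let ?B = "1 / (2 * exp 1 * (real ?n + 2)) * real ?n powr (real ?n / 2)"
  have q: "num_queries A w \<le> q" if "w \<in> space (seed_space A)" for w
  proof -
    have "enat (num_queries A w) \<le> complexity A"
      unfolding complexity_def using that by (intro SUP_upper)
    then show ?thesis by (simp add: enat)
  qed
  have n: "1 \<le> ?n" by (simp add: Suc_leI)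
  have one: "1 \<le> q"
    using query_lower_bound_one[OF assms(1) _ q] assms(2) by simp
  have pack: "(2 * real ?n - 2) ^ ?n - 2 ^ ?n \<le> 2 * real q * 5 ^ ?n" if "2 \<le> ?n"
    using query_lower_bound_packing[OF assms(1) _ _ q] assms(2) that by simp
  \<comment> \<open>Up to dimension 4 the claimed bound is below 1, so one query is enough; from 5
    to 8 the packing bound is evaluated numerically.\<close>
  consider "?n = 1" | "?n = 2" | "?n = 3" | "?n = 4" | "?n = 5" | "?n = 6" | "?n = 7" | "?n = 8" | "9 \<le> ?n"
    using n by linarith
  then have "?B \<le> real q"
  proof cases
    case 1 show ?thesis by (rule order_trans[OF powr_half_bound[of ?n 1]]) (use 1 one in simp_all)
  next
    case 2 show ?thesis by (rule order_trans[OF powr_half_bound[of ?n 1]]) (use 2 one in simp_all)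
  next
    case 3 show ?thesis by (rule order_trans[OF powr_half_bound[of ?n 2]]) (use 3 one in simp_all)
  next
    case 4 show ?thesis by (rule order_trans[OF powr_half_bound[of ?n 2]]) (use 4 one in simp_all)
  next
    case 5 show ?thesis by (rule order_trans[OF powr_half_bound[of ?n 3]]) (use 5 pack in simp_all)
  next
    case 6 show ?thesis by (rule order_trans[OF powr_half_bound[of ?n 3]]) (use 6 pack in simp_all)
  next
    case 7 show ?thesis by (rule order_trans[OF powr_half_bound[of ?n 4]]) (use 7 pack in simp_all)
  next
    case 8 show ?thesis by (rule order_trans[OF powr_half_bound[of ?n 4]]) (use 8 pack in simp_all)
  next
    case 9
    have "5 ^ ?n * (2 * ?B) \<le> 2 * real q * 5 ^ ?n"
      using packing_bound_large[OF 9] pack 9 by linarith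
    then have "2 * 5 ^ ?n * ?B \<le> 2 * 5 ^ ?n * real q" by (simp only: ac_simps)
    then show ?thesis by (rule mult_left_le_imp_le) simp
  qed
  then show ?thesis by (simp add: enat)
qed

end
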